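(* Let $n\ge 4$ and let $X=(12)^{\mathbb S_n}$ be the conjugacy class of transpositions in the symmetric group $\mathbb S_n$, regarded as a quandle under conjugation. Then $$H^2(X,\mathbb C^\times)\simeq\mathbb C^\times\times\langle\chi\rangle,$$ where $\langle\chi\rangle$ is the subgroup generated by (the class of) the $2$-cocycle $\chi\colon X\times X\to\mathbb C^\times$ defined, for $\sigma,\tau\in X$ with $\tau=(i\,j)$, $1\le i<j\le n$, by $$\chi(\sigma,\tau)=\begin{cases}1&\text{if }\sigma(i)<\sigma(j),\\-1&\text{otherwise.}\end{cases}$$
   Context: The quandle operation on $X$ is $x\triangleright y=xyx^{-1}$. Rack cohomology $H^2(X,\mathbb C^\times)$ (trivial coefficients): a 2-cocycle is a map $q\colon X\times X\to \mathbb C^\times$ with $q_{x\triangleright y,x\triangleright z}\,q_{x,z}=q_{x,y\triangleright z}\,q_{y,z}$ for all $x,y,z$; two cocycles $q,q'$ are equivalent if there is $\gamma\colon X\to \mathbb C^\times$ with $q'_{x,y}=q_{x,y}\gamma(x\triangleright y)\gamma(y)^{-1}$ for all $x,y$; $H^2(X,\mathbb C^\times)$ is the group of equivalence classes. The map $\chi$ is known to be a 2-cocycle. *)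

theory Defs
  imports Complex_Main "HOL-Algebra.Sym_Groups" "HOL-Algebra.Elementary_Groups"
begin

section \<open>Rack cohomology with values in the nonzero complex numbers\<close>

definition complex_units :: "complex monoid"
  where "complex_units = \<lparr> carrier = - {0}, monoid.mult = (*), one = 1 \<rparr>"

text \<open>
  A rack is a carrier set \<open>X\<close> with an operation \<open>opr\<close>. Functions on \<open>X \<times> X\<close> are
  extensional (equal to \<open>undefined\<close> off \<open>X \<times> X\<close>), so that equality of cocycles is
  equality on \<open>X \<times> X\<close>.
\<close>

locale rack =
  fixes X :: "'a set" and opr :: "'a \<Rightarrow> 'a \<Rightarrow> 'a" (infixr "\<triangleright>" 70)
  assumes bij: "x \<in> X \<Longrightarrow> bij_betw (opr x) X X"
    and distrib: "\<lbrakk>x \<in> X; y \<in> X; z \<in> X\<rbrakk> \<Longrightarrow> x \<triangleright> (y \<triangleright> z) = (x \<triangleright> y) \<triangleright> (x \<triangleright> z)"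

definition rack_cocycles :: "'a set \<Rightarrow> ('a \<Rightarrow> 'a \<Rightarrow> 'a) \<Rightarrow> ('a \<times> 'a \<Rightarrow> complex) set"
  where "rack_cocycles X opr =
    {q \<in> X \<times> X \<rightarrow>\<^sub>E - {0}. \<forall>x\<in>X. \<forall>y\<in>X. \<forall>z\<in>X.
       q (opr x y, opr x z) * q (x, z) = q (x, opr y z) * q (y, z)}"

definition rack_cocycle_group ::
    "'a set \<Rightarrow> ('a \<Rightarrow> 'a \<Rightarrow> 'a) \<Rightarrow> ('a \<times> 'a \<Rightarrow> complex) monoid"
  where "rack_cocycle_group X opr =
    \<lparr> carrier = rack_cocycles X opr,
      monoid.mult = (\<lambda>q q'. \<lambda>p\<in>X \<times> X. q p * q' p),
      one = (\<lambda>p\<in>X \<times> X. 1) \<rparr>"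

definition rack_cocycles_equivalent ::
    "'a set \<Rightarrow> ('a \<Rightarrow> 'a \<Rightarrow> 'a) \<Rightarrow> ('a \<times> 'a \<Rightarrow> complex) \<Rightarrow> ('a \<times> 'a \<Rightarrow> complex) \<Rightarrow> bool"
  where "rack_cocycles_equivalent X opr q q' \<longleftrightarrow>
    (\<exists>\<gamma> \<in> X \<rightarrow> - {0}. \<forall>x\<in>X. \<forall>y\<in>X. q' (x, y) = q (x, y) * \<gamma> (opr x y) * inverse (\<gamma> y))"

text \<open>
  The cocycles equivalent to the trivial one. The equivalence classes are exactly the cosets of
  this subgroup (lemma \<open>rack_class_eq_iff\<close> below).
\<close>

definition rack_coboundaries :: "'a set \<Rightarrow> ('a \<Rightarrow> 'a \<Rightarrow> 'a) \<Rightarrow> ('a \<times> 'a \<Rightarrow> complex) set"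
  where "rack_coboundaries X opr =
    {q \<in> rack_cocycles X opr. rack_cocycles_equivalent X opr (\<one>\<^bsub>rack_cocycle_group X opr\<^esub>) q}"

definition rack_H2 ::
    "'a set \<Rightarrow> ('a \<Rightarrow> 'a \<Rightarrow> 'a) \<Rightarrow> ('a \<times> 'a \<Rightarrow> complex) set monoid"
  where "rack_H2 X opr = rack_cocycle_group X opr Mod rack_coboundaries X opr"

definition rack_class ::
    "'a set \<Rightarrow> ('a \<Rightarrow> 'a \<Rightarrow> 'a) \<Rightarrow> ('a \<times> 'a \<Rightarrow> complex) \<Rightarrow> ('a \<times> 'a \<Rightarrow> complex) set"
  where "rack_class X opr q = rack_coboundaries X opr #>\<^bsub>rack_cocycle_group X opr\<^esub> q"

lemma rack_cocyclesD:
  assumes "q \<in> rack_cocycles X opr" "x \<in> X" "y \<in> X"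
  shows "q (x, y) \<noteq> 0"
  using assms by (auto simp: rack_cocycles_def PiE_def Pi_def)

lemma (in rack) closed [simp]: "x \<in> X \<Longrightarrow> y \<in> X \<Longrightarrow> x \<triangleright> y \<in> X"
  using bij bij_betwE by blast

lemma (in rack) comm_group_cocycles: "comm_group (rack_cocycle_group X opr)"
proof (rule comm_groupI)
  fix q q' assume "q \<in> carrier (rack_cocycle_group X opr)" "q' \<in> carrier (rack_cocycle_group X opr)"
  then have q: "q \<in> rack_cocycles X opr" and q': "q' \<in> rack_cocycles X opr"
    by (auto simp: rack_cocycle_group_def)
  have "q (x \<triangleright> y, x \<triangleright> z) * q' (x \<triangleright> y, x \<triangleright> z) * (q (x, z) * q' (x, z)) =
      q (x, y \<triangleright> z) * q' (x, y \<triangleright> z) * (q (y, z) * q' (y, z))"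
    if "x \<in> X" "y \<in> X" "z \<in> X" for x y z
  proof -
    have "q (x \<triangleright> y, x \<triangleright> z) * q (x, z) = q (x, y \<triangleright> z) * q (y, z)"
      "q' (x \<triangleright> y, x \<triangleright> z) * q' (x, z) = q' (x, y \<triangleright> z) * q' (y, z)"
      using q q' that by (auto simp: rack_cocycles_def)
    then show ?thesis by algebra
  qed
  then show "q \<otimes>\<^bsub>rack_cocycle_group X opr\<^esub> q' \<in> carrier (rack_cocycle_group X opr)"
    using rack_cocyclesD[OF q] rack_cocyclesD[OF q']
    by (auto simp: rack_cocycle_group_def rack_cocycles_def)
next
  show "\<one>\<^bsub>rack_cocycle_group X opr\<^esub> \<in> carrier (rack_cocycle_group X opr)"
    by (auto simp: rack_cocycle_group_def rack_cocycles_def)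
next
  fix q assume "q \<in> carrier (rack_cocycle_group X opr)"
  then have q: "q \<in> rack_cocycles X opr" by (simp add: rack_cocycle_group_def)
  then show "\<one>\<^bsub>rack_cocycle_group X opr\<^esub> \<otimes>\<^bsub>rack_cocycle_group X opr\<^esub> q = q"
    by (auto simp: rack_cocycle_group_def rack_cocycles_def fun_eq_iff PiE_def extensional_def)
  let ?i = "\<lambda>p\<in>X \<times> X. inverse (q p)"
  have "inverse (q (x \<triangleright> y, x \<triangleright> z)) * inverse (q (x, z)) = inverse (q (x, y \<triangleright> z)) * inverse (q (y, z))"
    if "x \<in> X" "y \<in> X" "z \<in> X" for x y z
    using q that by (simp add: rack_cocycles_def flip: inverse_mult_distrib)
  then have "?i \<in> rack_cocycles X opr"
    using rack_cocyclesD[OF q] by (auto simp: rack_cocycles_def)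
  moreover have "?i \<otimes>\<^bsub>rack_cocycle_group X opr\<^esub> q = \<one>\<^bsub>rack_cocycle_group X opr\<^esub>"
    using rack_cocyclesD[OF q] by (auto simp: rack_cocycle_group_def fun_eq_iff)
  ultimately show "\<exists>r\<in>carrier (rack_cocycle_group X opr).
      r \<otimes>\<^bsub>rack_cocycle_group X opr\<^esub> q = \<one>\<^bsub>rack_cocycle_group X opr\<^esub>"
    by (intro bexI[of _ ?i]) (simp_all add: rack_cocycle_group_def)
qed (auto simp: rack_cocycle_group_def fun_eq_iff mult_ac)

lemma (in rack) coboundary_cocycle:
  assumes "\<gamma> \<in> X \<rightarrow> - {0}"
  shows "(\<lambda>(x, y)\<in>X \<times> X. \<gamma> (x \<triangleright> y) * inverse (\<gamma> y)) \<in> rack_cocycles X opr"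
proof -
  have "\<gamma> x \<noteq> 0" if "x \<in> X" for x using assms that by auto
  then show ?thesis by (auto simp: rack_cocycles_def simp flip: distrib)
qed

lemma (in rack) coboundaries_eq:
  "rack_coboundaries X opr =
    (\<lambda>\<gamma>. \<lambda>(x, y)\<in>X \<times> X. \<gamma> (x \<triangleright> y) * inverse (\<gamma> y)) ` (X \<rightarrow> - {0})" (is "?L = ?R")
proof
  show "?L \<subseteq> ?R"
  proof
    fix q assume "q \<in> ?L"
    then obtain \<gamma> where "\<gamma> \<in> X \<rightarrow> - {0}" and q: "q \<in> extensional (X \<times> X)"
        "\<And>x y. x \<in> X \<Longrightarrow> y \<in> X \<Longrightarrow> q (x, y) = \<gamma> (x \<triangleright> y) * inverse (\<gamma> y)"
      by (auto simp: rack_coboundaries_def rack_cocycles_equivalent_def rack_cocycle_group_def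
          rack_cocycles_def PiE_def)
    moreover have "q = (\<lambda>(x, y)\<in>X \<times> X. \<gamma> (x \<triangleright> y) * inverse (\<gamma> y))"
      using q by (auto simp: fun_eq_iff extensional_def)
    ultimately show "q \<in> ?R" by blast
  qed
  show "?R \<subseteq> ?L"
  proof (rule image_subsetI)
    fix \<gamma> :: "'a \<Rightarrow> complex" assume g: "\<gamma> \<in> X \<rightarrow> - {0}"
    have "rack_cocycles_equivalent X opr (\<one>\<^bsub>rack_cocycle_group X opr\<^esub>)
        (\<lambda>(x, y)\<in>X \<times> X. \<gamma> (x \<triangleright> y) * inverse (\<gamma> y))"
      unfolding rack_cocycles_equivalent_def
      by (rule bexI[OF _ g]) (simp add: rack_cocycle_group_def)
    then show "(\<lambda>(x, y)\<in>X \<times> X. \<gamma> (x \<triangleright> y) * inverse (\<gamma> y)) \<in> rack_coboundaries X opr"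
      using coboundary_cocycle[OF g] by (simp add: rack_coboundaries_def)
  qed
qed

lemma (in rack) normal_coboundaries: "rack_coboundaries X opr \<lhd> rack_cocycle_group X opr"
proof -
  interpret Z: comm_group "rack_cocycle_group X opr" by (rule comm_group_cocycles)
  let ?d = "\<lambda>\<gamma>. \<lambda>(x, y)\<in>X \<times> X. \<gamma> (x \<triangleright> y) * inverse (\<gamma> y) :: complex"
  have carr: "?d \<gamma> \<in> carrier (rack_cocycle_group X opr)" if "\<gamma> \<in> X \<rightarrow> - {0}" for \<gamma>
    using coboundary_cocycle[OF that] by (simp add: rack_cocycle_group_def)
  have mult: "?d \<gamma> \<otimes>\<^bsub>rack_cocycle_group X opr\<^esub> ?d \<delta> = ?d (\<lambda>x. \<gamma> x * \<delta> x)" for \<gamma> \<delta>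
    by (auto simp: rack_cocycle_group_def fun_eq_iff)
  have inv: "inv\<^bsub>rack_cocycle_group X opr\<^esub> (?d \<gamma>) = ?d (\<lambda>x. inverse (\<gamma> x))"
    if g: "\<gamma> \<in> X \<rightarrow> - {0}" for \<gamma>
  proof (rule Z.inv_equality)
    have "\<gamma> x \<noteq> 0" if "x \<in> X" for x using g that by auto
    moreover have "inverse a * b * (a * inverse b) = (1 :: complex)" if "a \<noteq> 0" "b \<noteq> 0" for a b
      using that by (simp add: field_simps)
    ultimately show "?d (\<lambda>x. inverse (\<gamma> x)) \<otimes>\<^bsub>rack_cocycle_group X opr\<^esub> ?d \<gamma> = \<one>\<^bsub>rack_cocycle_group X opr\<^esub>"
      by (auto simp: rack_cocycle_group_def fun_eq_iff)
    show "?d \<gamma> \<in> carrier (rack_cocycle_group X opr)" by (rule carr[OF g])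
    show "?d (\<lambda>x. inverse (\<gamma> x)) \<in> carrier (rack_cocycle_group X opr)" using g by (intro carr) auto
  qed
  have "subgroup (rack_coboundaries X opr) (rack_cocycle_group X opr)"
    unfolding coboundaries_eq
  proof (rule Z.subgroupI)
    show "?d ` (X \<rightarrow> - {0}) \<subseteq> carrier (rack_cocycle_group X opr)"
      by (intro image_subsetI carr)
    have "(\<lambda>_. 1) \<in> X \<rightarrow> - {0 :: complex}" by auto
    then show "?d ` (X \<rightarrow> - {0}) \<noteq> {}" by blast
  next
    fix a assume "a \<in> ?d ` (X \<rightarrow> - {0})"
    then obtain \<gamma> where g: "\<gamma> \<in> X \<rightarrow> - {0}" "a = ?d \<gamma>" by blast
    have "(\<lambda>x. inverse (\<gamma> x)) \<in> X \<rightarrow> - {0}" using g by auto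
    then show "inv\<^bsub>rack_cocycle_group X opr\<^esub> a \<in> ?d ` (X \<rightarrow> - {0})"
      unfolding g(2) inv[OF g(1)] by (rule imageI)
  next
    fix a b assume "a \<in> ?d ` (X \<rightarrow> - {0})" "b \<in> ?d ` (X \<rightarrow> - {0})"
    then obtain \<gamma> \<delta> where g: "\<gamma> \<in> X \<rightarrow> - {0}" "a = ?d \<gamma>" "\<delta> \<in> X \<rightarrow> - {0}" "b = ?d \<delta>" by blast
    have "(\<lambda>x. \<gamma> x * \<delta> x) \<in> X \<rightarrow> - {0}" using g by auto
    then show "a \<otimes>\<^bsub>rack_cocycle_group X opr\<^esub> b \<in> ?d ` (X \<rightarrow> - {0})"
      unfolding g(2,4) mult by (rule imageI)
  qed
  then show ?thesis by (rule Z.subgroup_imp_normal)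
qed

lemma (in rack) group_H2: "group (rack_H2 X opr)"
  unfolding rack_H2_def by (rule normal.factorgroup_is_group[OF normal_coboundaries])

lemma (in rack) rack_class_eq:
  assumes q: "q \<in> rack_cocycles X opr"
  shows "rack_class X opr q = {q' \<in> rack_cocycles X opr. rack_cocycles_equivalent X opr q q'}"
proof -
  interpret Z: comm_group "rack_cocycle_group X opr" by (rule comm_group_cocycles)
  show ?thesis
  proof (intro Set.set_eqI iffI)
    fix q' assume "q' \<in> rack_class X opr q"
    then obtain b where b: "b \<in> rack_coboundaries X opr" "q' = b \<otimes>\<^bsub>rack_cocycle_group X opr\<^esub> q"
      by (auto simp: rack_class_def r_coset_def)
    then have "b \<in> carrier (rack_cocycle_group X opr)"
      by (simp add: rack_coboundaries_def rack_cocycle_group_def)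
    then have "q' \<in> rack_cocycles X opr"
      using b(2) q Z.m_closed[of b q] by (simp add: rack_cocycle_group_def)
    moreover have "rack_cocycles_equivalent X opr q q'"
      using b by (auto simp: rack_coboundaries_def rack_cocycles_equivalent_def
          rack_cocycle_group_def mult_ac)
    ultimately show "q' \<in> {q' \<in> rack_cocycles X opr. rack_cocycles_equivalent X opr q q'}" by simp
  next
    fix q' assume "q' \<in> {q' \<in> rack_cocycles X opr. rack_cocycles_equivalent X opr q q'}"
    then obtain \<gamma> where g: "\<gamma> \<in> X \<rightarrow> - {0}" and q': "q' \<in> extensional (X \<times> X)"
        "\<And>x y. x \<in> X \<Longrightarrow> y \<in> X \<Longrightarrow> q' (x, y) = q (x, y) * \<gamma> (x \<triangleright> y) * inverse (\<gamma> y)"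
      by (auto simp: rack_cocycles_equivalent_def rack_cocycles_def PiE_def)
    let ?b = "\<lambda>(x, y)\<in>X \<times> X. \<gamma> (x \<triangleright> y) * inverse (\<gamma> y)"
    have "?b \<in> rack_coboundaries X opr" using g coboundaries_eq by blast
    moreover have "q' = ?b \<otimes>\<^bsub>rack_cocycle_group X opr\<^esub> q"
      using q' by (auto simp: rack_cocycle_group_def fun_eq_iff extensional_def)
    ultimately show "q' \<in> rack_class X opr q" by (auto simp: rack_class_def r_coset_def)
  qed
qed

lemma (in rack) carrier_H2: "carrier (rack_H2 X opr) = rack_class X opr ` rack_cocycles X opr"
  by (auto simp: rack_H2_def FactGroup_def RCOSETS_def rack_class_def rack_cocycle_group_def)

lemma (in rack) rack_class_eq_iff:
  assumes q: "q \<in> rack_cocycles X opr" and q': "q' \<in> rack_cocycles X opr"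
  shows "rack_class X opr q = rack_class X opr q' \<longleftrightarrow> rack_cocycles_equivalent X opr q q'"
proof -
  interpret Z: comm_group "rack_cocycle_group X opr" by (rule comm_group_cocycles)
  have sub: "subgroup (rack_coboundaries X opr) (rack_cocycle_group X opr)"
    using normal_coboundaries normal_imp_subgroup by blast
  have carr: "q \<in> carrier (rack_cocycle_group X opr)" "q' \<in> carrier (rack_cocycle_group X opr)"
    using q q' by (simp_all add: rack_cocycle_group_def)
  have "q' \<in> rack_class X opr q'"
    unfolding rack_class_def using Z.rcos_self[OF carr(2) sub] .
  moreover have "rack_class X opr q = rack_class X opr q'" if "q' \<in> rack_class X opr q"
    using Z.repr_independence[OF _ carr(1) sub] that by (simp add: rack_class_def)
  ultimately show ?thesis using rack_class_eq[OF q] q' by auto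
qed


section \<open>Conjugacy classes as quandles, and the transpositions\<close>

definition conj_op :: "('a, 'b) monoid_scheme \<Rightarrow> 'a \<Rightarrow> 'a \<Rightarrow> 'a"
  where "conj_op G x y = x \<otimes>\<^bsub>G\<^esub> y \<otimes>\<^bsub>G\<^esub> inv\<^bsub>G\<^esub> x"

definition conj_class :: "('a, 'b) monoid_scheme \<Rightarrow> 'a \<Rightarrow> 'a set"
  where "conj_class G a = (\<lambda>g. conj_op G g a) ` carrier G"

lemma (in group) conj_op_mult:
  assumes "x \<in> carrier G" "y \<in> carrier G" "z \<in> carrier G"
  shows "conj_op G x (conj_op G y z) = conj_op G (x \<otimes> y) z"
  using assms by (simp add: conj_op_def m_assoc inv_mult_group)

lemma (in group) rack_conj_class:
  assumes a: "a \<in> carrier G"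
  shows "rack (conj_class G a) (conj_op G)"
proof
  have sub: "conj_class G a \<subseteq> carrier G"
    using a by (auto simp: conj_class_def conj_op_def)
  have closed: "conj_op G x y \<in> conj_class G a" if x: "x \<in> carrier G" and y: "y \<in> conj_class G a" for x y
  proof -
    obtain g where g: "g \<in> carrier G" "y = conj_op G g a" using y by (auto simp: conj_class_def)
    then have "conj_op G x y = conj_op G (x \<otimes> g) a" using x a by (simp add: conj_op_mult)
    then show ?thesis using x g by (auto simp: conj_class_def)
  qed
  fix x assume x: "x \<in> conj_class G a"
  then have xc: "x \<in> carrier G" using sub by blast
  have canc: "conj_op G (inv x) (conj_op G x y) = y" "conj_op G x (conj_op G (inv x) y) = y"
    if "y \<in> conj_class G a" for y
  proof -
    have yc: "y \<in> carrier G" using that sub by blast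
    have "conj_op G \<one> y = y" using yc by (simp add: conj_op_def)
    then show "conj_op G (inv x) (conj_op G x y) = y" "conj_op G x (conj_op G (inv x) y) = y"
      using xc yc by (simp_all add: conj_op_mult)
  qed
  show "bij_betw (conj_op G x) (conj_class G a) (conj_class G a)"
    by (rule bij_betw_byWitness[where f' = "conj_op G (inv x)"]) (use canc closed xc in auto)
  fix y z assume "y \<in> conj_class G a" "z \<in> conj_class G a"
  then have yz: "y \<in> carrier G" "z \<in> carrier G" using sub by blast+
  have "conj_op G x y \<otimes> x = x \<otimes> y"
    using xc yz by (simp add: conj_op_def m_assoc)
  moreover have "conj_op G x y \<in> carrier G" using xc yz by (simp add: conj_op_def)
  ultimately show "conj_op G x (conj_op G y z) = conj_op G (conj_op G x y) (conj_op G x z)"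
    using xc yz by (simp add: conj_op_mult)
qed

abbreviation transposition_class :: "nat \<Rightarrow> (nat \<Rightarrow> nat) set"
  where "transposition_class n \<equiv> conj_class (sym_group n) (transpose 1 2)"

text \<open>
  The pair \<open>i < j\<close> with \<open>\<tau> = transpose i j\<close> is determined by \<open>\<tau>\<close> (lemma \<open>chi_transpose\<close>).
\<close>

definition chi :: "nat \<Rightarrow> (nat \<Rightarrow> nat) \<times> (nat \<Rightarrow> nat) \<Rightarrow> complex"
  where "chi n = (\<lambda>(\<sigma>, \<tau>) \<in> transposition_class n \<times> transposition_class n.
    if \<exists>i j. 1 \<le> i \<and> i < j \<and> j \<le> n \<and> \<tau> = transpose i j \<and> \<sigma> i < \<sigma> j then 1 else - 1)"

lemma transpose_ordered_eq_iff:
  fixes i j k l :: nat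
  assumes "i < j" "k < l"
  shows "transpose i j = transpose k l \<longleftrightarrow> i = k \<and> j = l"
proof
  assume eq: "transpose i j = transpose k l"
  have "transpose k l i = j" "transpose k l j = i" by (simp_all flip: eq)
  then show "i = k \<and> j = l"
    using assms by (auto simp: transpose_def split: if_splits)
qed simp

lemma chi_transpose:
  assumes "\<sigma> \<in> transposition_class n" "transpose i j \<in> transposition_class n"
    and "1 \<le> i" "i < j" "j \<le> n"
  shows "chi n (\<sigma>, transpose i j) = (if \<sigma> i < \<sigma> j then 1 else - 1)"
  using assms by (auto simp: chi_def transpose_ordered_eq_iff)

lemma conj_op_transpose:
  assumes p: "p permutes {1..n}"
  shows "conj_op (sym_group n) p (transpose a b) = transpose (p a) (p b)"
proof -
  have "p \<circ> transpose a b = transpose (p a) (p b) \<circ> p"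
    using transpose_comp_eq[OF permutes_bij[OF p], of "p a" "p b"] by (simp add: permutes_inverses[OF p])
  then have "p \<circ> transpose a b \<circ> Hilbert_Choice.inv p = transpose (p a) (p b)"
    by (simp add: comp_assoc permutes_inv_o[OF p])
  moreover have "p \<in> carrier (sym_group n)" using p by (simp add: sym_group_carrier)
  ultimately show ?thesis by (simp add: conj_op_def sym_group_mult)
qed

lemma transposition_class_eq:
  assumes "n \<ge> 2"
  shows "transposition_class n = {transpose i j | i j. 1 \<le> i \<and> i < j \<and> j \<le> n}"
proof
  note conj = conj_op_transpose[of _ n 1 2]
  show "transposition_class n \<subseteq> {transpose i j | i j. 1 \<le> i \<and> i < j \<and> j \<le> n}"
  proof
    fix t assume "t \<in> transposition_class n"
    then obtain p where p: "p permutes {1..n}" "t = transpose (p 1) (p 2)"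
      using conj by (auto simp: conj_class_def sym_group_carrier)
    have r: "p 1 \<in> {1..n}" "p 2 \<in> {1..n}" using assms permutes_in_image[OF p(1)] by auto
    have "p 1 \<noteq> p 2" using permutes_inj[OF p(1)] by (metis injD one_eq_numeral_iff numeral_One num.distinct(1))
    then consider "p 1 < p 2" | "p 2 < p 1" by linarith
    then show "t \<in> {transpose i j | i j. 1 \<le> i \<and> i < j \<and> j \<le> n}"
    proof cases
      case 1 then show ?thesis using p(2) r by auto
    next
      case 2
      have "t = transpose (p 2) (p 1)" using p(2) by (simp add: transpose_commute)
      then show ?thesis using 2 r by fastforce
    qed
  qed
  show "{transpose i j | i j. 1 \<le> i \<and> i < j \<and> j \<le> n} \<subseteq> transposition_class n"
  proof clarify
    fix i j :: nat assume ij: "1 \<le> i" "i < j" "j \<le> n"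
    let ?p = "transpose 1 i \<circ> transpose 2 (transpose 1 i j)"
    have "transpose 1 i j \<in> {1..n}" using ij by (auto simp: transpose_def)
    then have p: "?p permutes {1..n}"
      using ij assms by (intro permutes_compose permutes_swap_id) auto
    have "?p 1 = i" "?p 2 = j" using ij by (auto simp: transpose_def)
    then have "transpose i j = conj_op (sym_group n) ?p (transpose 1 2)" using conj[OF p] by simp
    then show "transpose i j \<in> transposition_class n"
      using p by (auto simp: conj_class_def sym_group_carrier)
  qed
qed

lemma rack_transpositions:
  assumes "n \<ge> 2"
  shows "rack (transposition_class n) (conj_op (sym_group n))"
  using assms
  by (intro group.rack_conj_class sym_group_is_group) (auto simp: sym_group_carrier intro: permutes_swap_id)

lemma chi_cocycle:
  assumes n: "n \<ge> 2"
  shows "chi n \<in> rack_cocycles (transposition_class n) (conj_op (sym_group n))"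
proof -
  define X where "X = transposition_class n"
  let ?o = "conj_op (sym_group n)"
  interpret rack X ?o unfolding X_def by (rule rack_transpositions[OF n])
  have X_eq: "X = {transpose i j | i j. 1 \<le> i \<and> i < j \<and> j \<le> n}"
    unfolding X_def by (rule transposition_class_eq[OF n])
  define sg :: "(nat \<Rightarrow> nat) \<Rightarrow> nat \<Rightarrow> nat \<Rightarrow> complex"
    where "sg p i j = (if (p i < p j) = (i < j) then 1 else - 1)" for p i j
  have carr: "x permutes {1..n}" "inj x" if "x \<in> X" for x
    using that by (auto simp: X_eq intro!: permutes_swap_id inj_on_transpose)
  have opr: "?o x (transpose i j) = transpose (x i) (x j)" if "x \<in> X" for x i j
    by (rule conj_op_transpose[OF carr(1)[OF that]])
  have chi: "chi n (x, transpose i j) = sg x i j"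
    if x: "x \<in> X" and ij: "i \<noteq> j" and t: "transpose i j \<in> X" for x i j
  proof -
    obtain k l where kl: "1 \<le> k" "k < l" "l \<le> n" "transpose i j = transpose k l"
      using t by (auto simp: X_eq)
    have "x k \<noteq> x l" using carr(2)[OF x] kl by (metis injD less_irrefl)
    have "(i = k \<and> j = l) \<or> (i = l \<and> j = k)"
    proof (cases "i < j")
      case True then show ?thesis using kl transpose_ordered_eq_iff by blast
    next
      case False
      then have "j < i" "transpose j i = transpose k l" using ij kl by (auto simp: transpose_commute)
      then show ?thesis using kl transpose_ordered_eq_iff by blast
    qed
    then show ?thesis
      using chi_transpose[OF x[unfolded X_def] _ kl(1-3)] t[unfolded X_def] kl \<open>x k \<noteq> x l\<close> by (auto simp: sg_def)
  qed
  have "chi n (?o x y, ?o x z) * chi n (x, z) = chi n (x, ?o y z) * chi n (y, z)"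
    if X: "x \<in> X" "y \<in> X" "z \<in> X" for x y z
  proof -
    obtain i j where ij: "i < j" "z = transpose i j" using X by (auto simp: X_eq)
    have neq: "x i \<noteq> x j" "y i \<noteq> y j" using ij carr(2) X by (metis injD less_irrefl)+
    have neq': "x (y i) \<noteq> x (y j)" using neq carr(2) X by (metis injD)
    obtain k l where y: "y = transpose k l" using X by (auto simp: X_eq)
    have v: "?o x y (x m) = x (y m)" for m
      unfolding y opr[OF X(1)] using carr(2)[OF X(1)] by (auto simp: transpose_def inj_eq)
    have 1: "?o x z = transpose (x i) (x j)" "?o y z = transpose (y i) (y j)"
      using opr ij X by auto
    have in': "?o x z \<in> X" "?o y z \<in> X" "?o x y \<in> X" using X by auto
    have "chi n (?o x y, ?o x z) = sg (?o x y) (x i) (x j)"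
      "chi n (x, ?o y z) = sg x (y i) (y j)" "chi n (x, z) = sg x i j" "chi n (y, z) = sg y i j"
      using chi 1 in' neq X ij by auto
    then show ?thesis using neq neq' by (auto simp: sg_def v)
  qed
  moreover have "chi n \<in> X \<times> X \<rightarrow>\<^sub>E - {0}" unfolding X_def chi_def by (intro restrict_PiE[THEN iffD2]) (auto split: if_splits)
  ultimately show ?thesis unfolding rack_cocycles_def X_def by blast
qed

end

theory Submission
  imports Defs
begin

text \<open>
  A cocycle \<open>q\<close> lets the elements of \<open>X\<close> act on \<open>X \<times> \<complex>\<^sup>*\<close> by
  \<open>x \<cdot> (z, a) = (x \<triangleright> z, q (x, z) * a)\<close>, and the cocycle condition says precisely that
  \<open>x \<cdot> (y \<cdot> v) = (x \<triangleright> y) \<cdot> (x \<cdot> v)\<close>. Choosing an equivalent cocycle means changing the origin in each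
  fibre. If \<open>y \<triangleright> z = z\<close>, then \<open>y\<close> maps the fibre over \<open>z\<close> to itself, so the number \<open>q (y, z)\<close> depends
  only on the class of \<open>q\<close>, and it is unchanged when \<open>y\<close> and \<open>z\<close> are conjugated simultaneously. For
  transpositions this leaves two numbers: the common value \<open>d\<close> of all \<open>q (x, x)\<close>, and the common value
  \<open>s\<close> of all \<open>q (x, z)\<close> with \<open>x\<close> and \<open>z\<close> disjoint. These determine the class:

  \<^item> The double action of \<open>x\<close> covers the identity of \<open>X\<close> and commutes with everything, so it
    multiplies all fibres by one and the same number. Reading this number off over \<open>x\<close> itself and
    over a transposition disjoint from \<open>x\<close> gives \<open>d\<^sup>2 = s\<^sup>2\<close> (\<open>invariants_agree_up_to_sign\<close>).

  \<^item> Suppose that \<open>d = s = 1\<close>. Regard transpositions as edges of the complete graph on \<open>{1..n}\<close>. The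
    only values of \<open>q\<close> that are left transport the edge \<open>{b, c}\<close> to the edge \<open>{a, c}\<close> by means of the
    transposition of \<open>a\<close> and \<open>b\<close>. This transport is transitive around each vertex
    (\<open>transport_trans\<close>) and compatible around each triangle (\<open>transport_triangle\<close>), so transporting
    from the edge \<open>{1, 2}\<close> defines a function on edges whose coboundary is \<open>q\<close> (\<open>is_coboundary\<close>).

  \<^item> Applied to the quotient of two cocycles, this shows that cocycles are equivalent if and only if
    they share \<open>d\<close> and \<open>s\<close> (\<open>transposition_cocycles_equivalent_iff\<close>). Hence the second cohomology group
    is the group of all pairs \<open>(d, s)\<close> of nonzero numbers with \<open>d = \<plusminus> s\<close>. The constant cocycles realise the pairs \<open>(c, c)\<close>
    and \<open>chi\<close> realises \<open>(- 1, 1)\<close>.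
\<close>

section \<open>Cocycles on racks\<close>

context rack
begin

lemma cocycle_cond:
  assumes "q \<in> rack_cocycles X opr" "x \<in> X" "y \<in> X" "z \<in> X"
  shows "q (x \<triangleright> y, x \<triangleright> z) * q (x, z) = q (x, y \<triangleright> z) * q (y, z)"
  using assms by (simp add: rack_cocycles_def)

text \<open>
  The middle factors \<open>q (x, z)\<close> and \<open>q (x, y \<triangleright> z)\<close> of the cocycle condition coincide and cancel.
\<close>

lemma cocycle_invariant_at_fixing_pair:
  assumes q: "q \<in> rack_cocycles X opr" and X: "x \<in> X" "y \<in> X" "z \<in> X" and "y \<triangleright> z = z"
  shows "q (x \<triangleright> y, x \<triangleright> z) = q (y, z)"
  using cocycle_cond[OF q X] rack_cocyclesD[OF q, of x z] assms by simp

text \<open>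
  This provides the invariants of cohomology classes: if \<open>y\<close> fixes \<open>z\<close>, the two values of \<open>\<gamma>\<close> cancel.
\<close>

lemma equivalent_eq_at_fixing_pair:
  assumes "rack_cocycles_equivalent X opr q q'" and X: "y \<in> X" "z \<in> X" and "y \<triangleright> z = z"
  shows "q' (y, z) = q (y, z)"
proof -
  obtain \<gamma> where \<gamma>: "\<gamma> \<in> X \<rightarrow> - {0}"
    and eq: "\<forall>x\<in>X. \<forall>y\<in>X. q' (x, y) = q (x, y) * \<gamma> (x \<triangleright> y) * inverse (\<gamma> y)"
    using assms(1) by (auto simp: rack_cocycles_equivalent_def)
  have "\<gamma> z \<noteq> 0" using \<gamma> X by auto
  then show ?thesis using eq X \<open>y \<triangleright> z = z\<close> by simp
qed

text \<open>
  If \<open>x\<close> acts on \<open>X\<close> as an involution, acting twice by \<open>x\<close> multiplies the fibre over \<open>z\<close> by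
  \<open>q (x, x \<triangleright> z) * q (x, z)\<close>. Since \<open>x \<triangleright> (x \<triangleright> y) = y\<close>, the double action commutes with the action of
  \<open>y\<close>, so the factor over \<open>y \<triangleright> z\<close> is the same as over \<open>z\<close>.
\<close>

lemma square_factor_invariant:
  assumes q: "q \<in> rack_cocycles X opr" and X: "x \<in> X" "y \<in> X" "z \<in> X"
    and inv: "\<And>w. w \<in> X \<Longrightarrow> x \<triangleright> (x \<triangleright> w) = w"
  shows "q (x, x \<triangleright> (y \<triangleright> z)) * q (x, y \<triangleright> z) = q (x, x \<triangleright> z) * q (x, z)"
proof -
  \<comment> \<open>Move \<open>x\<close> past \<open>y\<close>, and then once more past \<open>x \<triangleright> y\<close>, which turns it back into \<open>y\<close>.\<close>
  have 1: "q (x \<triangleright> y, x \<triangleright> z) * q (x, z) = q (x, y \<triangleright> z) * q (y, z)"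
    using cocycle_cond[OF q X] .
  have 2: "q (y, z) * q (x, x \<triangleright> z) = q (x, x \<triangleright> (y \<triangleright> z)) * q (x \<triangleright> y, x \<triangleright> z)"
    using cocycle_cond[OF q X(1), of "x \<triangleright> y" "x \<triangleright> z"] X inv by (simp flip: distrib)
  have "q (x \<triangleright> y, x \<triangleright> z) \<noteq> 0" "q (y, z) \<noteq> 0"
    using rack_cocyclesD[OF q] X by auto
  moreover have "(q (x, x \<triangleright> (y \<triangleright> z)) * q (x, y \<triangleright> z)) * (q (x \<triangleright> y, x \<triangleright> z) * q (y, z)) =
      (q (x, x \<triangleright> z) * q (x, z)) * (q (x \<triangleright> y, x \<triangleright> z) * q (y, z))"
    using 1 2 by algebra
  ultimately show ?thesis by simp
qed

lemma cocycle_divide: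
  assumes q: "q \<in> rack_cocycles X opr" and q': "q' \<in> rack_cocycles X opr"
  shows "(\<lambda>p\<in>X \<times> X. q' p / q p) \<in> rack_cocycles X opr"
proof -
  have "q' (x \<triangleright> y, x \<triangleright> z) / q (x \<triangleright> y, x \<triangleright> z) * (q' (x, z) / q (x, z)) =
      q' (x, y \<triangleright> z) / q (x, y \<triangleright> z) * (q' (y, z) / q (y, z))"
    if "x \<in> X" "y \<in> X" "z \<in> X" for x y z
    using cocycle_cond[OF q that] cocycle_cond[OF q' that] by simp
  then show ?thesis
    using rack_cocyclesD[OF q] rack_cocyclesD[OF q'] by (auto simp: rack_cocycles_def)
qed

lemma constant_cocycle: "c \<noteq> 0 \<Longrightarrow> (\<lambda>p\<in>X \<times> X. c) \<in> rack_cocycles X opr"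
  by (auto simp: rack_cocycles_def)

lemma rack_class_mult:
  assumes "q \<in> rack_cocycles X opr" "q' \<in> rack_cocycles X opr"
  shows "rack_class X opr q \<otimes>\<^bsub>rack_H2 X opr\<^esub> rack_class X opr q' =
    rack_class X opr (\<lambda>p\<in>X \<times> X. q p * q' p)"
  using normal.rcos_sum[OF normal_coboundaries, of q q'] assms
  by (simp add: rack_H2_def FactGroup_def rack_class_def rack_cocycle_group_def)

lemma cocycle_mult:
  assumes "q \<in> rack_cocycles X opr" "q' \<in> rack_cocycles X opr"
  shows "(\<lambda>p\<in>X \<times> X. q p * q' p) \<in> rack_cocycles X opr"
proof -
  interpret Z: comm_group "rack_cocycle_group X opr" by (rule comm_group_cocycles)
  show ?thesis using Z.m_closed[of q q'] assms by (simp add: rack_cocycle_group_def)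
qed

lemma rack_class_one: "\<one>\<^bsub>rack_H2 X opr\<^esub> = rack_class X opr (\<lambda>p\<in>X \<times> X. 1)"
proof -
  interpret Z: comm_group "rack_cocycle_group X opr" by (rule comm_group_cocycles)
  have sub: "rack_coboundaries X opr \<subseteq> carrier (rack_cocycle_group X opr)"
    by (auto simp: rack_coboundaries_def rack_cocycle_group_def)
  show ?thesis
    using Z.coset_mult_one[OF sub]
    by (simp add: rack_H2_def FactGroup_def rack_class_def rack_cocycle_group_def)
qed

lemma comm_group_H2: "comm_group (rack_H2 X opr)"
proof -
  interpret H: group "rack_H2 X opr" by (rule group_H2)
  show ?thesis
    by (rule H.group_comm_groupI)
      (auto simp: carrier_H2 rack_class_mult mult.commute cong: restrict_cong)
qed

end

section \<open>Invariants of cocycles on transpositions\<close>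

lemma ex_permutes_map_eq:
  assumes "finite S" "distinct xs" "distinct ys" "length xs = length ys" "set xs \<subseteq> S" "set ys \<subseteq> S"
  shows "\<exists>p. p permutes S \<and> map p xs = ys"
  using assms(4,2,3,5,6)
proof (induction xs ys rule: list_induct2)
  case Nil
  show ?case by (intro exI[of _ id]) (simp add: permutes_def)
next
  case (Cons x xs y ys)
  then obtain p where p: "p permutes S" "map p xs = ys" by auto
  \<comment> \<open>Correct \<open>p\<close> by swapping \<open>p x\<close> with \<open>y\<close>; neither occurs in \<open>ys\<close>, so the other values survive.\<close>
  have "p x \<notin> set ys"
    using Cons.prems(1) p permutes_inj[OF p(1)] by (auto simp: inj_eq)
  then have "map (transpose (p x) y) ys = ys"
    using Cons.prems(2) by (intro map_idI transpose_apply_other) auto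
  then have "map (transpose (p x) y) (map p (x # xs)) = y # ys"
    by (simp add: p(2))
  then have "map (transpose (p x) y \<circ> p) (x # xs) = y # ys"
    by (simp only: map_map)
  moreover have "transpose (p x) y \<circ> p permutes S"
    using Cons.prems by (intro permutes_compose[OF p(1)] permutes_swap_id) (auto simp: permutes_in_image[OF p(1)])
  ultimately show ?case by (intro exI conjI)
qed

lemma transpose_in_class:
  assumes "a \<in> {1..n}" "b \<in> {1..n}" "a \<noteq> b"
  shows "transpose a b \<in> transposition_class n"
proof -
  have "transpose a b = transpose (min a b) (max a b)"
    by (cases "a \<le> b") (simp_all add: min_def max_def transpose_commute[of a b])
  moreover have "2 \<le> n" "1 \<le> min a b" "min a b < max a b" "max a b \<le> n"
    using assms by auto
  ultimately show ?thesis
    unfolding transposition_class_eq[OF \<open>2 \<le> n\<close>] by blast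
qed

lemma transposition_classE:
  assumes "t \<in> transposition_class n" "n \<ge> 2"
  obtains a b where "a \<in> {1..n}" "b \<in> {1..n}" "a \<noteq> b" "t = transpose a b"
proof -
  obtain i j where "t = transpose i j" "1 \<le> i" "i < j" "j \<le> n"
    using assms(1) unfolding transposition_class_eq[OF assms(2)] by blast
  then show thesis by (intro that[of i j]) auto
qed

lemma conj_op_transpose_transpose:
  assumes "a \<in> {1..n}" "b \<in> {1..n}"
  shows "conj_op (sym_group n) (transpose a b) (transpose c d) =
    transpose (transpose a b c) (transpose a b d)"
  by (intro conj_op_transpose permutes_swap_id assms)

locale transposition_cocycle =
  fixes n :: nat and q :: "(nat \<Rightarrow> nat) \<times> (nat \<Rightarrow> nat) \<Rightarrow> complex"
  assumes four_le: "4 \<le> n"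
    and cocycle: "q \<in> rack_cocycles (transposition_class n) (conj_op (sym_group n))"
begin

lemma two_le: "2 \<le> n"
  using four_le by simp

sublocale rack "transposition_class n" "conj_op (sym_group n)"
  by (rule rack_transpositions[OF two_le])

lemma nonzero:
  assumes "a \<in> {1..n}" "b \<in> {1..n}" "a \<noteq> b" "c \<in> {1..n}" "d \<in> {1..n}" "c \<noteq> d"
  shows "q (transpose a b, transpose c d) \<noteq> 0"
  using assms by (intro rack_cocyclesD[OF cocycle] transpose_in_class)

text \<open>
  Conjugation by a single transposition is an instance of \<open>cocycle_invariant_at_fixing_pair\<close>, and
  transpositions generate the symmetric group. The last hypothesis says that the first transposition
  fixes the second one under conjugation.
\<close>

lemma cocycle_permute:
  assumes p: "p permutes {1..n}"
    and ab: "a \<in> {1..n}" "b \<in> {1..n}" "a \<noteq> b" and cd: "c \<in> {1..n}" "d \<in> {1..n}" "c \<noteq> d"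
    and fix_cd: "transpose (transpose a b c) (transpose a b d) = transpose c d"
  shows "q (transpose (p a) (p b), transpose (p c) (p d)) = q (transpose a b, transpose c d)"
proof -
  show ?thesis using p finite_atLeastAtMost[of 1 n]
  proof (induction p rule: permutes_induct)
    case id
    show ?case by (simp only: id_apply)
  next
    case (swap i j p)
    have p: "p permutes {1..n}" by fact
    have inj: "p u = p v \<longleftrightarrow> u = v" for u v using permutes_inj[OF p] by (simp add: inj_eq)
    have mem: "p u \<in> {1..n} \<longleftrightarrow> u \<in> {1..n}" for u by (rule permutes_in_image[OF p])
    have com: "transpose (p a) (p b) (p u) = p (transpose a b u)" for u
      by (simp add: transpose_def inj)
    have "conj_op (sym_group n) (transpose (p a) (p b)) (transpose (p c) (p d)) =
        transpose (transpose (p a) (p b) (p c)) (transpose (p a) (p b) (p d))"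
      by (intro conj_op_transpose_transpose mem[THEN iffD2] ab)
    also have "\<dots> = conj_op (sym_group n) p (transpose (transpose a b c) (transpose a b d))"
      unfolding com conj_op_transpose[OF p] ..
    also have "\<dots> = transpose (p c) (p d)"
      unfolding fix_cd conj_op_transpose[OF p] ..
    finally have commute: "conj_op (sym_group n) (transpose (p a) (p b)) (transpose (p c) (p d)) =
        transpose (p c) (p d)" .
    have X: "transpose i j \<in> transposition_class n"
        "transpose (p a) (p b) \<in> transposition_class n"
        "transpose (p c) (p d) \<in> transposition_class n"
      by (simp_all add: transpose_in_class swap.hyps ab cd mem inj del: One_nat_def atLeastAtMost_iff)
    have "q (conj_op (sym_group n) (transpose i j) (transpose (p a) (p b)),
        conj_op (sym_group n) (transpose i j) (transpose (p c) (p d))) =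
        q (transpose (p a) (p b), transpose (p c) (p d))"
      by (rule cocycle_invariant_at_fixing_pair[OF cocycle X commute])
    then show ?case
      using swap.IH swap.hyps(1,2) by (simp add: conj_op_transpose_transpose)
  qed
qed

lemma diagonal_constant:
  assumes "a \<in> {1..n}" "b \<in> {1..n}" "a \<noteq> b"
  shows "q (transpose a b, transpose a b) = q (transpose 1 2, transpose 1 2)"
proof -
  have "\<exists>p. p permutes {1..n} \<and> map p [1, 2] = [a, b]"
    by (rule ex_permutes_map_eq) (use assms four_le in simp_all)
  then obtain p where p: "p permutes {1..n}" "p 1 = a" "p 2 = b" by auto
  have "q (transpose (p 1) (p 2), transpose (p 1) (p 2)) = q (transpose 1 2, transpose 1 2)"
    by (rule cocycle_permute[OF p(1)]) (use four_le in \<open>auto simp: transpose_commute\<close>)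
  then show ?thesis unfolding p(2,3) .
qed

lemma disjoint_constant:
  assumes "distinct [a, b, c, d]" "{a, b, c, d} \<subseteq> {1..n}"
  shows "q (transpose a b, transpose c d) = q (transpose 3 4, transpose 1 2)"
proof -
  have "\<exists>p. p permutes {1..n} \<and> map p [3, 4, 1, 2] = [a, b, c, d]"
    by (rule ex_permutes_map_eq) (use assms four_le in simp_all)
  then obtain p where p: "p permutes {1..n}" "p 3 = a" "p 4 = b" "p 1 = c" "p 2 = d" by auto
  have "q (transpose (p 3) (p 4), transpose (p 1) (p 2)) = q (transpose 3 4, transpose 1 2)"
    by (rule cocycle_permute[OF p(1)]) (use four_le in auto)
  then show ?thesis unfolding p(2-5) .
qed

lemma involutive:
  assumes "x \<in> transposition_class n" "y \<in> transposition_class n"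
  shows "conj_op (sym_group n) x (conj_op (sym_group n) x y) = y"
proof -
  obtain a b where ab: "a \<in> {1..n}" "b \<in> {1..n}" "a \<noteq> b" "x = transpose a b"
    by (rule transposition_classE[OF assms(1) two_le])
  obtain c d where "c \<in> {1..n}" "d \<in> {1..n}" "c \<noteq> d" and y: "y = transpose c d"
    by (rule transposition_classE[OF assms(2) two_le])
  show ?thesis
    unfolding ab(4) y by (simp only: conj_op_transpose_transpose[OF ab(1,2)] transpose_involutory)
qed

text \<open>
  The next two lemmas evaluate the square factor of \<open>transpose a b\<close> over all transpositions: the
  transposition of \<open>a\<close> and \<open>c\<close> carries \<open>transpose b c\<close> to \<open>transpose a b\<close>, and a transposition
  disjoint from \<open>transpose a b\<close> to one that shares the letter \<open>a\<close> with it.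
\<close>

lemma meeting_square_factor:
  assumes "distinct [a, b, c]" "{a, b, c} \<subseteq> {1..n}"
  shows "q (transpose a b, transpose a c) * q (transpose a b, transpose b c) =
    q (transpose a b, transpose a b) ^ 2"
proof -
  have mem: "a \<in> {1..n}" "b \<in> {1..n}" "c \<in> {1..n}" using assms(2) by simp_all
  have neq: "a \<noteq> b" "b \<noteq> a" "a \<noteq> c" "c \<noteq> a" "b \<noteq> c" "c \<noteq> b" using assms(1) by auto
  note X = transpose_in_class[OF mem(1,2) neq(1)] transpose_in_class[OF mem(1,3) neq(3)]
    transpose_in_class[OF mem(2,3) neq(5)]
  show ?thesis
    using square_factor_invariant[OF cocycle X involutive[OF X(1)]]
    by (simp add: conj_op_transpose_transpose[OF mem(1,2)] conj_op_transpose_transpose[OF mem(1,3)]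
        neq transpose_commute[of b a] power2_eq_square)
qed

lemma disjoint_square_factor:
  assumes "distinct [a, b, c, d]" "{a, b, c, d} \<subseteq> {1..n}"
  shows "q (transpose a b, transpose c d) ^ 2 = q (transpose a b, transpose a b) ^ 2"
proof -
  have mem: "a \<in> {1..n}" "b \<in> {1..n}" "c \<in> {1..n}" "d \<in> {1..n}" using assms(2) by simp_all
  have neq: "a \<noteq> b" "a \<noteq> c" "c \<noteq> d" "b \<noteq> c" "d \<noteq> a" "d \<noteq> b" "d \<noteq> c" "c \<noteq> a" "c \<noteq> b"
    using assms(1) by auto
  note X = transpose_in_class[OF mem(1,2) neq(1)] transpose_in_class[OF mem(1,3) neq(2)]
    transpose_in_class[OF mem(3,4) neq(3)]
  have "q (transpose a b, transpose b d) * q (transpose a b, transpose a d) =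
      q (transpose a b, transpose c d) ^ 2"
    using square_factor_invariant[OF cocycle X involutive[OF X(1)]]
    by (simp add: conj_op_transpose_transpose[OF mem(1,2)] conj_op_transpose_transpose[OF mem(1,3)]
        neq power2_eq_square)
  moreover have "q (transpose a b, transpose a d) * q (transpose a b, transpose b d) =
      q (transpose a b, transpose a b) ^ 2"
    by (rule meeting_square_factor) (use assms in simp_all)
  ultimately show ?thesis by (simp add: mult.commute)
qed

lemma invariants_agree_up_to_sign:
  "q (transpose 1 2, transpose 1 2) = q (transpose 3 4, transpose 1 2) \<or>
   q (transpose 1 2, transpose 1 2) = - q (transpose 3 4, transpose 1 2)"
proof -
  have "q (transpose 3 4, transpose 1 2) ^ 2 = q (transpose 3 4, transpose 3 4) ^ 2"
    by (rule disjoint_square_factor) (use four_le in simp_all)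
  also have "q (transpose 3 4, transpose 3 4) = q (transpose 1 2, transpose 1 2)"
    by (rule diagonal_constant) (use four_le in simp_all)
  finally show ?thesis by (metis power2_eq_iff)
qed

end

section \<open>Cocycles with trivial invariants are coboundaries\<close>

locale unit_transposition_cocycle = transposition_cocycle +
  assumes diagonal_one: "q (transpose 1 2, transpose 1 2) = 1"
    and disjoint_one: "q (transpose 3 4, transpose 1 2) = 1"
begin

text \<open>
  The factor for moving the edge \<open>{c, b}\<close> to the edge \<open>{c, a}\<close> about their common vertex \<open>c\<close>.
\<close>

definition transport :: "nat \<Rightarrow> nat \<Rightarrow> nat \<Rightarrow> complex"
  where "transport c b a = (if a = b then 1 else q (transpose a b, transpose b c))"

lemma transport_nonzero:
  assumes "{a, b, c} \<subseteq> {1..n}" "c \<noteq> b"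
  shows "transport c b a \<noteq> 0"
  using nonzero[of a b b c] assms by (auto simp: transport_def)

text \<open>
  For distinct \<open>a\<close>, \<open>b\<close>, \<open>d\<close> this is the cocycle condition at the transpositions of \<open>a, b\<close>, of \<open>b, d\<close>
  and of \<open>d, c\<close>; its fourth factor belongs to a disjoint pair and is \<open>1\<close>. Going back and forth
  (\<open>a = d\<close>) is trivial because the square factor is \<open>1\<close>.
\<close>

lemma transport_trans:
  assumes "{a, b, c, d} \<subseteq> {1..n}" "c \<notin> {a, b, d}"
  shows "transport c d b * transport c b a = transport c d a"
proof -
  have mem: "a \<in> {1..n}" "b \<in> {1..n}" "c \<in> {1..n}" "d \<in> {1..n}" using assms(1) by simp_all
  consider "a = b \<or> b = d" | "a \<noteq> b" "a = d" | "distinct [a, b, d]" by auto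
  then show ?thesis
  proof cases
    case 1
    then show ?thesis by (auto simp: transport_def)
  next
    case 2
    have "q (transpose a b, transpose a c) * q (transpose a b, transpose b c) =
        q (transpose a b, transpose a b) ^ 2"
      by (rule meeting_square_factor) (use 2 assms in simp_all)
    also have "\<dots> = 1"
      using diagonal_constant[OF mem(1,2) 2(1)] diagonal_one by simp
    finally show ?thesis using 2 by (auto simp: transport_def transpose_commute[of b d])
  next
    case 3
    then have neq: "a \<noteq> b" "b \<noteq> d" "d \<noteq> c" "a \<noteq> d" "d \<noteq> a" "d \<noteq> b" "c \<noteq> a" "c \<noteq> b" "c \<noteq> d" "b \<noteq> a"
      using assms(2) by auto
    note X = transpose_in_class[OF mem(1,2) neq(1)] transpose_in_class[OF mem(2,4) neq(2)]
      transpose_in_class[OF mem(4,3) neq(3)]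
    have "q (transpose a b, transpose d c) = 1"
      using disjoint_constant[of a b d c] disjoint_one 3 assms by simp
    moreover have "q (transpose a d, transpose d c) * q (transpose a b, transpose d c) =
        q (transpose a b, transpose b c) * q (transpose b d, transpose d c)"
      using cocycle_cond[OF cocycle X]
      by (simp add: conj_op_transpose_transpose[OF mem(1,2)] conj_op_transpose_transpose[OF mem(2,4)] neq)
    ultimately show ?thesis by (simp add: transport_def neq)
  qed
qed

text \<open>
  Two ways from the edge \<open>{a, b}\<close> to the edge \<open>{b, c}\<close>: directly, or by way of \<open>{a, c}\<close>.
\<close>

lemma transport_triangle:
  assumes "distinct [a, b, c]" "{a, b, c} \<subseteq> {1..n}"
  shows "transport b a c = transport a b c * transport c a b"
proof -
  have mem: "a \<in> {1..n}" "b \<in> {1..n}" "c \<in> {1..n}" using assms(2) by simp_all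
  have neq: "a \<noteq> b" "b \<noteq> a" "a \<noteq> c" "c \<noteq> a" "b \<noteq> c" "c \<noteq> b" using assms(1) by auto
  note X = transpose_in_class[OF mem(1,2) neq(1)] transpose_in_class[OF mem(2,3) neq(5)]
  have "q (transpose a b, transpose a b) = 1"
    using diagonal_constant[OF mem(1,2) neq(1)] diagonal_one by simp
  moreover have "q (transpose a c, transpose a b) * q (transpose a b, transpose a b) =
      q (transpose a b, transpose a c) * q (transpose b c, transpose a b)"
    using cocycle_cond[OF cocycle X X(1)]
    by (simp add: conj_op_transpose_transpose[OF mem(1,2)] conj_op_transpose_transpose[OF mem(2,3)] neq
        transpose_commute[of b a])
  ultimately show ?thesis
    by (simp add: transport_def neq transpose_commute[of c a] transpose_commute[of b a]
        transpose_commute[of c b] mult.commute)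
qed

text \<open>
  The factor of the path \<open>{1, 2} \<rightarrow> {1, i} \<rightarrow> {i, j}\<close>, whose first step turns about \<open>1\<close> and whose second
  step turns about \<open>i\<close>. The edges at \<open>1\<close> need their own clause, since transport about \<open>1\<close> cannot start
  from a degenerate edge \<open>{1, 1}\<close>.
\<close>

definition edge_potential :: "nat \<Rightarrow> nat \<Rightarrow> complex"
  where "edge_potential i j =
    (if i = 1 then transport 1 2 j else transport 1 2 i * transport i 1 j)"

lemma edge_potential_nonzero:
  assumes "{i, j} \<subseteq> {1..n}" "i \<noteq> j"
  shows "edge_potential i j \<noteq> 0"
  using assms four_le by (auto simp: edge_potential_def transport_nonzero)

lemma edge_potential_transport:
  assumes "{i, j, k} \<subseteq> {1..n}" "i \<notin> {j, k}"
  shows "edge_potential i j * transport i j k = edge_potential i k"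
proof (cases "i = 1")
  case True
  have "transport 1 2 j * transport 1 j k = transport 1 2 k"
    by (rule transport_trans) (use assms True four_le in auto)
  then show ?thesis unfolding edge_potential_def using True by simp
next
  case False
  have "transport i 1 j * transport i j k = transport i 1 k"
    by (rule transport_trans) (use assms False four_le in auto)
  then show ?thesis unfolding edge_potential_def using False by (simp add: mult.assoc)
qed

text \<open>
  Independence of the order of \<open>i\<close> and \<open>j\<close> is where the triangle relation enters: it compares the
  paths to \<open>{i, j}\<close> through \<open>{1, i}\<close> and through \<open>{1, j}\<close>.
\<close>

lemma edge_potential_commute:
  assumes "{i, j} \<subseteq> {1..n}" "i \<noteq> j"
  shows "edge_potential i j = edge_potential j i"
proof -
  consider "i = 1" | "j = 1" | "distinct [1, i, j]" using assms(2) by auto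
  then show ?thesis
  proof cases
    case 3
    have "transport i 1 j = transport 1 i j * transport j 1 i"
      by (rule transport_triangle) (use 3 assms four_le in auto)
    moreover have "transport 1 2 i * transport 1 i j = transport 1 2 j"
      by (rule transport_trans) (use 3 assms four_le in auto)
    ultimately show ?thesis using 3 by (auto simp: edge_potential_def)
  qed (use assms in \<open>simp_all add: edge_potential_def transport_def\<close>)
qed

text \<open>
  The edge is recovered from the transposition as a moved point together with its image. By
  \<open>edge_potential_commute\<close> the choice of the moved point is irrelevant; \<open>LEAST\<close> is just one choice.
\<close>

definition potential :: "(nat \<Rightarrow> nat) \<Rightarrow> complex"
  where "potential t = (let i = (LEAST i. t i \<noteq> i) in edge_potential i (t i))"

lemma potential_transpose:
  assumes "{a, b} \<subseteq> {1..n}" "a \<noteq> b"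
  shows "potential (transpose a b) = edge_potential a b"
proof -
  have "transpose a b (LEAST i. transpose a b i \<noteq> i) \<noteq> (LEAST i. transpose a b i \<noteq> i)"
    by (rule LeastI[of _ a]) (use assms in simp)
  then have "(LEAST i. transpose a b i \<noteq> i) \<in> {a, b}"
    using transpose_apply_other by fastforce
  then show ?thesis
    using edge_potential_commute[OF assms] by (auto simp: potential_def Let_def)
qed

lemma potential_meeting:
  assumes "distinct [a, b, c]" "{a, b, c} \<subseteq> {1..n}"
  shows "q (transpose a b, transpose b c) * potential (transpose b c) = potential (transpose a c)"
proof -
  have "potential (transpose b c) = edge_potential c b" "potential (transpose a c) = edge_potential c a"
    using assms potential_transpose[of c b] potential_transpose[of c a]
    by (simp_all add: transpose_commute[of c])
  moreover have "edge_potential c b * transport c b a = edge_potential c a"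
    by (rule edge_potential_transport) (use assms in auto)
  ultimately show ?thesis using assms by (simp add: transport_def mult.commute)
qed

lemma is_coboundary:
  "\<exists>\<gamma> \<in> transposition_class n \<rightarrow> - {0}. \<forall>x \<in> transposition_class n. \<forall>y \<in> transposition_class n.
     q (x, y) = \<gamma> (conj_op (sym_group n) x y) * inverse (\<gamma> y)"
proof (intro bexI ballI)
  have nz: "potential t \<noteq> 0" if t: "t \<in> transposition_class n" for t
  proof -
    obtain a b where "a \<in> {1..n}" "b \<in> {1..n}" "a \<noteq> b" "t = transpose a b"
      by (rule transposition_classE[OF t two_le])
    then show ?thesis using potential_transpose edge_potential_nonzero by simp
  qed
  then show "potential \<in> transposition_class n \<rightarrow> - {0}" by simp
  fix x y assume x: "x \<in> transposition_class n" and y: "y \<in> transposition_class n"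
  obtain a b where ab: "a \<in> {1..n}" "b \<in> {1..n}" "a \<noteq> b" "x = transpose a b"
    by (rule transposition_classE[OF x two_le])
  obtain c d where cd: "c \<in> {1..n}" "d \<in> {1..n}" "c \<noteq> d" "y = transpose c d"
    by (rule transposition_classE[OF y two_le])
  note opr = conj_op_transpose_transpose[OF ab(1,2)]
  have same: "q (transpose a b, transpose a b) = 1"
    using diagonal_constant[OF ab(1-3)] diagonal_one by simp
  consider "c = a \<and> d = b \<or> c = b \<and> d = a" | "distinct [a, b, c, d]" | "c = a" "d \<notin> {a, b}" | "c = b" "d \<notin> {a, b}"
    | "d = a" "c \<notin> {a, b}" | "d = b" "c \<notin> {a, b}"
    using ab(3) cd(3) by auto
  then have "q (x, y) * potential y = potential (conj_op (sym_group n) x y)"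
  proof cases
    case 1
    then show ?thesis using ab cd opr same by (auto simp: transpose_commute[of b a])
  next
    case 2
    then show ?thesis
      using disjoint_constant[of a b c d] disjoint_one ab cd opr by simp
  next
    case 3
    then show ?thesis
      using potential_meeting[of b a d] ab cd opr by (simp add: transpose_commute[of b a])
  next
    case 4
    then show ?thesis using potential_meeting[of a b d] ab cd opr by simp
  next
    case 5
    then show ?thesis
      using potential_meeting[of b a c] ab cd opr
      by (simp add: transpose_commute[of b a] transpose_commute[of c])
  next
    case 6
    then show ?thesis
      using potential_meeting[of a b c] ab cd opr by (simp add: transpose_commute[of c])
  qed
  then show "q (x, y) = potential (conj_op (sym_group n) x y) * inverse (potential y)"
    using nz[OF y] by (simp add: field_simps)
qed

end

section \<open>The second cohomology group\<close>

text \<open>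
  Both \<open>transpose 1 2\<close> and \<open>transpose 3 4\<close> fix \<open>transpose 1 2\<close>, so the two values are invariants.
  Conversely, if they agree, the quotient of the cocycles has trivial invariants.
\<close>

theorem transposition_cocycles_equivalent_iff:
  assumes n: "4 \<le> n"
    and q: "q \<in> rack_cocycles (transposition_class n) (conj_op (sym_group n))"
    and q': "q' \<in> rack_cocycles (transposition_class n) (conj_op (sym_group n))"
  shows "rack_cocycles_equivalent (transposition_class n) (conj_op (sym_group n)) q q' \<longleftrightarrow>
    q' (transpose 1 2, transpose 1 2) = q (transpose 1 2, transpose 1 2) \<and>
    q' (transpose 3 4, transpose 1 2) = q (transpose 3 4, transpose 1 2)"
    (is "?equiv \<longleftrightarrow> ?agree")
proof
  let ?X = "transposition_class n" and ?o = "conj_op (sym_group n)"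
  interpret rack ?X ?o by (rule rack_transpositions) (use n in simp)
  have mem: "(1::nat) \<in> {1..n}" "2 \<in> {1..n}" "3 \<in> {1..n}" "4 \<in> {1..n}" using n by auto
  have t: "transpose 1 2 \<in> ?X" "transpose 3 4 \<in> ?X"
    using mem by (auto intro!: transpose_in_class simp del: One_nat_def)
  have fixed: "?o (transpose 1 2) (transpose 1 2) = transpose 1 2"
    "?o (transpose 3 4) (transpose 1 2) = transpose 1 2"
    unfolding conj_op_transpose_transpose[OF mem(1,2)] conj_op_transpose_transpose[OF mem(3,4)]
    by (simp_all add: transpose_commute[of 2] transpose_apply_other del: One_nat_def)
  {
    assume ?equiv
    then show ?agree using equivalent_eq_at_fixing_pair t fixed by blast
  next
    assume agree: ?agree
    let ?r = "\<lambda>p\<in>?X \<times> ?X. q' p / q p"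
    have "unit_transposition_cocycle n ?r"
    proof
      show "?r \<in> rack_cocycles ?X ?o" by (rule cocycle_divide[OF q q'])
    qed (use n agree t rack_cocyclesD[OF q] in \<open>simp_all del: One_nat_def\<close>)
    then obtain \<gamma> where \<gamma>: "\<gamma> \<in> ?X \<rightarrow> - {0}"
      and r: "\<forall>x\<in>?X. \<forall>y\<in>?X. ?r (x, y) = \<gamma> (?o x y) * inverse (\<gamma> y)"
      using unit_transposition_cocycle.is_coboundary by blast
    have "q' (x, y) = q (x, y) * \<gamma> (?o x y) * inverse (\<gamma> y)" if "x \<in> ?X" "y \<in> ?X" for x y
    proof -
      have "q' (x, y) / q (x, y) = \<gamma> (?o x y) * inverse (\<gamma> y)" using r that by simp
      then show ?thesis using rack_cocyclesD[OF q that] by (simp add: field_simps)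
    qed
    then show ?equiv using \<gamma> unfolding rack_cocycles_equivalent_def by blast
  }
qed

lemma group_complex_units: "group complex_units"
proof (rule groupI)
  fix z assume "z \<in> carrier complex_units"
  then show "\<exists>w\<in>carrier complex_units. w \<otimes>\<^bsub>complex_units\<^esub> z = \<one>\<^bsub>complex_units\<^esub>"
    by (intro bexI[of _ "inverse z"]) (simp_all add: complex_units_def)
qed (auto simp: complex_units_def)

text \<open>
  The two invariants of the constant cocycle \<open>c\<close> are \<open>(c, c)\<close>, and those of \<open>chi\<close> are \<open>(- 1, 1)\<close>;
  in particular the class of \<open>chi\<close> has order two. All pairs of invariants are of the form
  \<open>(\<plusminus> c, c)\<close>, so each class is in exactly one way a constant class times an element of the
  subgroup generated by the class of \<open>chi\<close>.
\<close>

theorem theorem5p5: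
  fixes n :: nat
  assumes "n \<ge> 4"
  shows "let X = conj_class (sym_group n) (transpose 1 2);
             H2 = rack_H2 X (conj_op (sym_group n))
         in H2 \<cong> complex_units \<times>\<times>
              subgroup_generated H2 {rack_class X (conj_op (sym_group n)) (chi n)}"
proof -
  define X where "X = transposition_class n"
  define opr where "opr = conj_op (sym_group n)"
  define H where "H = rack_H2 X opr"
  define cls where "cls = rack_class X opr"
  define const :: "complex \<Rightarrow> (nat \<Rightarrow> nat) \<times> (nat \<Rightarrow> nat) \<Rightarrow> complex"
    where "const c = (\<lambda>p\<in>X \<times> X. c)" for c
  define e where "e = cls (chi n)"
  define f :: "complex \<times> ((nat \<Rightarrow> nat) \<times> (nat \<Rightarrow> nat) \<Rightarrow> complex) set \<Rightarrow> _"
    where "f = (\<lambda>(c, h). cls (const c) \<otimes>\<^bsub>H\<^esub> h)"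
  interpret rack X opr
    unfolding X_def opr_def by (rule rack_transpositions) (use assms in simp)
  interpret H: comm_group H unfolding H_def by (rule comm_group_H2)
  let ?d = "(transpose 1 2 :: nat \<Rightarrow> nat, transpose 1 2 :: nat \<Rightarrow> nat)"
  let ?s = "(transpose 3 4 :: nat \<Rightarrow> nat, transpose 1 2 :: nat \<Rightarrow> nat)"
  have t: "transpose 1 2 \<in> X" "transpose 3 4 \<in> X"
    unfolding X_def by (rule transpose_in_class; use assms in simp)+
  have ds: "?d \<in> X \<times> X" "?s \<in> X \<times> X" using t by (simp_all del: One_nat_def)
  have cls_eq_iff: "cls q = cls q' \<longleftrightarrow> q' ?d = q ?d \<and> q' ?s = q ?s"
    if "q \<in> rack_cocycles X opr" "q' \<in> rack_cocycles X opr" for q q'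
    using rack_class_eq_iff[OF that] transposition_cocycles_equivalent_iff[OF assms] that
    unfolding cls_def X_def opr_def by blast
  have chi: "chi n \<in> rack_cocycles X opr"
    unfolding X_def opr_def by (rule chi_cocycle) (use assms in simp)
  have chi_d: "chi n ?d = - 1"
    using chi_transpose[of "transpose 1 2" n 1 2] t assms unfolding X_def by (simp del: One_nat_def)
  have chi_s: "chi n ?s = 1"
    using chi_transpose[of "transpose 3 4" n 1 2] t assms unfolding X_def by (simp del: One_nat_def)
  have const: "const c \<in> rack_cocycles X opr" if "c \<noteq> 0" for c
    unfolding const_def by (rule constant_cocycle[OF that])
  have const_ds: "const c ?d = c" "const c ?s = c" for c
    using ds by (simp_all add: const_def del: One_nat_def)
  have mult: "cls q \<otimes>\<^bsub>H\<^esub> cls q' = cls (\<lambda>p\<in>X \<times> X. q p * q' p)"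
    if "q \<in> rack_cocycles X opr" "q' \<in> rack_cocycles X opr" for q q'
    unfolding H_def cls_def by (rule rack_class_mult[OF that])
  have one: "\<one>\<^bsub>H\<^esub> = cls (const 1)"
    unfolding H_def cls_def const_def by (rule rack_class_one)
  have carrier_H: "carrier H = cls ` rack_cocycles X opr"
    unfolding H_def cls_def by (rule carrier_H2)
  have closed: "cls q \<in> carrier H" if "q \<in> rack_cocycles X opr" for q
    using that by (simp add: carrier_H)
  have e: "e \<in> carrier H" unfolding e_def by (rule closed[OF chi])
  have ee: "e \<otimes>\<^bsub>H\<^esub> e = \<one>\<^bsub>H\<^esub>"
    unfolding e_def one mult[OF chi chi]
    using cls_eq_iff[OF cocycle_mult[OF chi chi] const[OF one_neq_zero]] ds chi_d chi_s const_ds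
    by (simp del: One_nat_def)
  have gen: "carrier (subgroup_generated H {e}) = {\<one>\<^bsub>H\<^esub>, e}"
  proof
    have "inv\<^bsub>H\<^esub> e = e" using ee e by (simp add: H.inv_equality)
    then have "subgroup {\<one>\<^bsub>H\<^esub>, e} H"
      using e ee by (intro H.subgroupI) auto
    then show "carrier (subgroup_generated H {e}) \<subseteq> {\<one>\<^bsub>H\<^esub>, e}"
      by (intro H.subgroup_generated_minimal) auto
    show "{\<one>\<^bsub>H\<^esub>, e} \<subseteq> carrier (subgroup_generated H {e})"
      using e by (auto simp: carrier_subgroup_generated generate.one intro: generate.incl)
  qed
  have gen_cls: "{\<one>\<^bsub>H\<^esub>, e} = cls ` {const 1, chi n}"
    by (simp add: one e_def)
  have f_cls: "f (c, cls q) = cls (\<lambda>p\<in>X \<times> X. const c p * q p)"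
    if "c \<noteq> 0" "q \<in> rack_cocycles X opr" for c q
    using mult[OF const[OF that(1)] that(2)] by (simp add: f_def)
  have prod: "(\<lambda>p\<in>X \<times> X. const c p * q p) \<in> rack_cocycles X opr"
    if "c \<noteq> 0" "q \<in> rack_cocycles X opr" for c q
    by (rule cocycle_mult[OF const[OF that(1)] that(2)])
  have prod_ds: "(\<lambda>p\<in>X \<times> X. const c p * q p) ?d = c * q ?d"
    "(\<lambda>p\<in>X \<times> X. const c p * q p) ?s = c * q ?s" for c q
    using ds by (simp_all add: const_def del: One_nat_def)
  let ?P = "complex_units \<times>\<times> subgroup_generated H {e}"
  have carrier_P: "carrier ?P = (- {0}) \<times> {\<one>\<^bsub>H\<^esub>, e}"
    by (simp add: gen complex_units_def)
  have "f \<in> iso ?P H"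
  proof (intro isoI homI)
    have "cls (const (c * c')) = cls (const c) \<otimes>\<^bsub>H\<^esub> cls (const c')" if "c \<noteq> 0" "c' \<noteq> 0" for c c'
      unfolding mult[OF const[OF that(1)] const[OF that(2)]]
      by (rule arg_cong[of _ _ cls]) (auto simp: const_def)
    moreover fix x y assume "x \<in> carrier ?P" "y \<in> carrier ?P"
    moreover have "{\<one>\<^bsub>H\<^esub>, e} \<subseteq> carrier H" using e by simp
    ultimately show "f (x \<otimes>\<^bsub>?P\<^esub> y) = f x \<otimes>\<^bsub>H\<^esub> f y"
      using closed[OF const] unfolding carrier_P
      by (clarsimp simp: f_def mult_DirProd complex_units_def) (auto simp: H.m_ac)
  next
    fix x assume "x \<in> carrier ?P"
    then show "f x \<in> carrier H"
      using closed[OF const] e unfolding carrier_P by (auto simp: f_def)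
  next
    show "bij_betw f (carrier ?P) (carrier H)"
      unfolding bij_betw_def
    proof
      show "inj_on f (carrier ?P)"
      proof (rule inj_onI)
        fix x y assume xy: "x \<in> carrier ?P" "y \<in> carrier ?P" "f x = f y"
        obtain c q where x: "x = (c, cls q)" "c \<noteq> 0" "q \<in> {const 1, chi n}"
          using xy(1) unfolding carrier_P gen_cls by blast
        obtain c' q' where y: "y = (c', cls q')" "c' \<noteq> 0" "q' \<in> {const 1, chi n}"
          using xy(2) unfolding carrier_P gen_cls by blast
        have q: "q \<in> rack_cocycles X opr" "q' \<in> rack_cocycles X opr"
          using x(3) y(3) const[of 1] chi by auto
        have s: "q ?s = 1" "q' ?s = 1" using x(3) y(3) chi_s const_ds by auto
        have "c' * q' ?d = c * q ?d" "c' * q' ?s = c * q ?s"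
          using xy(3) unfolding x(1) y(1) f_cls[OF x(2) q(1)] f_cls[OF y(2) q(2)]
            cls_eq_iff[OF prod[OF x(2) q(1)] prod[OF y(2) q(2)]] prod_ds by auto
        \<comment> \<open>The second invariant gives the constant, the first one then tells \<open>1\<close> and \<open>chi\<close> apart.\<close>
        then have "c' = c" "q' ?d = q ?d" using s x(2) by auto
        then show "x = y"
          using cls_eq_iff[OF q] s x(1) y(1) by simp
      qed
      show "f ` carrier ?P = carrier H"
      proof
        show "f ` carrier ?P \<subseteq> carrier H"
          using closed[OF const] e unfolding carrier_P by (auto simp: f_def)
        show "carrier H \<subseteq> f ` carrier ?P"
        proof
          fix h assume "h \<in> carrier H"
          then obtain q where q: "q \<in> rack_cocycles X opr" "h = cls q"
            unfolding carrier_H by blast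
          have "transposition_cocycle n q"
            using q(1) assms unfolding X_def opr_def by unfold_locales
          then have sign: "q ?d = q ?s \<or> q ?d = - q ?s"
            by (rule transposition_cocycle.invariants_agree_up_to_sign)
          have nz: "q ?s \<noteq> 0" using rack_cocyclesD[OF q(1)] t by blast
          \<comment> \<open>The invariants of \<open>q\<close> divided by \<open>q ?s\<close> are \<open>(\<plusminus> 1, 1)\<close>, those of \<open>1\<close> or of \<open>chi\<close>.\<close>
          obtain r where r: "r \<in> {const 1, chi n}" "q ?d = q ?s * r ?d" "r ?s = 1"
            using sign chi_d chi_s const_ds by force
          have r_cocycle: "r \<in> rack_cocycles X opr" using r(1) const[of 1] chi by auto
          have "h = f (q ?s, cls r)"
            unfolding f_cls[OF nz r_cocycle] q(2) cls_eq_iff[OF q(1) prod[OF nz r_cocycle]] prod_ds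
            using r(2,3) by simp
          moreover have "(q ?s, cls r) \<in> carrier ?P"
            unfolding carrier_P gen_cls using nz r(1) by blast
          ultimately show "h \<in> f ` carrier ?P" by blast
        qed
      qed
    qed
  qed
  then have "?P \<cong> H" by (rule is_isoI)
  moreover have "group ?P"
  proof (rule DirProd_group)
    show "group complex_units" by (rule group_complex_units)
    show "group (subgroup_generated H {e})" by (rule H.group_subgroup_generated)
  qed
  ultimately have "H \<cong> ?P" by (rule group.iso_sym[rotated])
  then show ?thesis
    unfolding H_def e_def cls_def X_def opr_def Let_def .
qed

end
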